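(* For any symmetric positive semi-definite matrix $G\in\mathbb{R}^{n\times n}$ and its symmetric approximation $\tilde G\in\mathbb{R}^{n\times n}$, the matrix-based Rényi $\alpha$-order entropy of $\tilde G$ satisfies $$\big|\mathbf S_\alpha(G)-\mathbf S_\alpha(\tilde G)\big|\le\Big|\frac{\alpha}{1-\alpha}\log_2\big(1-\sqrt n\,\|G^{-1}\|_2\,\|G-\tilde G\|_2\big)\Big|.$$
   Context: The matrix-based Rényi entropy of order $\alpha>0$, $\alpha\neq1$, of an $n\times n$ matrix $A$ is $\mathbf S_\alpha(A)=\frac1{1-\alpha}\log_2(\mathrm{tr}(A^\alpha))=\frac1{1-\alpha}\log_2\big(\sum_{i=1}^n\lambda_i^\alpha(A)\big)$, where $\lambda_i(A)$ is the $i$-th eigenvalue of $A$. $\|\cdot\|_2$ is the spectral norm.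
   Formalization: G is assumed invertible (so that G^{-1} exists) and 1 − √n‖G^{-1}‖₂‖G−G̃‖₂ is assumed positive (so that the logarithm on the right is defined); without these conditions the stated bound has no meaning. *)

theory Defs
  imports "HOL-Analysis.Analysis" "HOL-Computational_Algebra.Computational_Algebra"
begin

definition charpoly :: "real ^ 'n ^ 'n \<Rightarrow> real poly" where
  "charpoly A = det (\<chi> i j. (if i = j then [:0, 1:] else 0) - [:A $ i $ j:])"

text \<open>
  The real eigenvalues, counted with algebraic multiplicity. For a symmetric matrix the
  characteristic polynomial splits over the reals, so this multiset has exactly
  \<^term>\<open>CARD('n)\<close> elements.
\<close>
definition eigenvalues :: "real ^ 'n ^ 'n \<Rightarrow> real multiset" where
  "eigenvalues A = proots (charpoly A)"

definition symmetric_matrix :: "real ^ 'n ^ 'n \<Rightarrow> bool" where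
  "symmetric_matrix A \<longleftrightarrow> transpose A = A"

definition pos_semidef :: "real ^ 'n ^ 'n \<Rightarrow> bool" where
  "pos_semidef A \<longleftrightarrow> symmetric_matrix A \<and> (\<forall>x. 0 \<le> x \<bullet> (A *v x))"

text \<open>The operator norm induced by the Euclidean norm.\<close>
definition spectral_norm :: "real ^ 'n ^ 'm \<Rightarrow> real" where
  "spectral_norm A = onorm (\<lambda>x. A *v x)"

text \<open>
  The trace of \<open>A\<^sup>\<alpha>\<close> is the sum of the \<open>\<alpha>\<close>-th powers of the eigenvalues. The definition is
  meaningful for symmetric positive semidefinite \<open>A\<close> only, since the powers and the logarithm
  are totalised outside their domains.
\<close>
definition renyi_entropy :: "real \<Rightarrow> real ^ 'n ^ 'n \<Rightarrow> real" where
  "renyi_entropy \<alpha> A = 1 / (1 - \<alpha>) * log 2 (\<Sum>l\<in>#eigenvalues A. l powr \<alpha>)"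

end

theory Submission
  imports Defs
begin

text \<open>
  Put \<open>\<delta> = \<parallel>G\<^sup>-\<^sup>1\<parallel> \<parallel>G - G'\<parallel>\<close>. Since \<open>\<parallel>x\<parallel>\<^sup>2 \<le> \<parallel>G\<^sup>-\<^sup>1\<parallel> x\<^sup>T G x\<close>, the quadratic forms satisfy
  \<open>(1 - \<delta>) G \<le> G' \<le> (1 + \<delta>) G\<close>. By a dimension count, a larger quadratic form has, for every
  \<open>t\<close>, at least as many eigenvalues above \<open>t\<close>, so \<open>tr G'\<^sup>\<alpha>\<close> lies between \<open>(1 - \<delta>)\<^sup>\<alpha> tr G\<^sup>\<alpha>\<close> and
  \<open>(1 + \<delta>)\<^sup>\<alpha> tr G\<^sup>\<alpha>\<close>. Now take logarithms and use \<open>1 + \<delta> \<le> 1 / (1 - \<delta>)\<close> and \<open>\<delta> \<le> \<surd>n \<delta>\<close>.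
\<close>

section \<open>Spectral theorem for real symmetric matrices\<close>

lemma symmetric_matrix_inner:
  fixes A :: "real ^ 'n ^ 'n"
  assumes "symmetric_matrix A"
  shows "x \<bullet> (A *v y) = (A *v x) \<bullet> y"
  using assms by (metis dot_lmul_matrix symmetric_matrix_def transpose_matrix_vector)

lemma exists_orthogonal_vector:
  fixes S :: "'a::euclidean_space set"
  assumes "finite S" "card S < DIM('a)"
  obtains x where "x \<noteq> 0" "\<And>y. y \<in> S \<Longrightarrow> x \<bullet> y = 0"
proof -
  have "dim S < DIM('a)"
    using assms dim_le_card'[of S] by simp
  then obtain x where "x \<noteq> 0" "\<And>y. y \<in> span S \<Longrightarrow> orthogonal x y"
    using orthogonal_to_subspace_exists by blast
  then show thesis
    using that by (auto simp: orthogonal_def span_base)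
qed

text \<open>The vector \<open>v\<close> maximises the quadratic form of \<open>A\<close> on the unit
  sphere of the orthogonal complement \<open>W\<close> of \<open>S\<close>. Because \<open>S\<close>
  consists of eigenvectors and \<open>A\<close> is symmetric, \<open>A\<close> maps \<open>W\<close>
  into itself, so the first-order condition inside \<open>W\<close> is the full eigenvector
  equation.\<close>

lemma symmetric_matrix_eigenvector_orthogonal:
  fixes A :: "real ^ 'n ^ 'n"
  assumes sym: "symmetric_matrix A"
    and fin: "finite S" and card: "card S < CARD('n)"
    and eig: "\<And>u. u \<in> S \<Longrightarrow> \<exists>l. A *v u = l *\<^sub>R u"
  obtains v m where "norm v = 1" "A *v v = m *\<^sub>R v" "\<And>u. u \<in> S \<Longrightarrow> v \<bullet> u = 0"
proof -
  define W where "W = {x. \<forall>u\<in>S. x \<bullet> u = 0}"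
  define K where "K = sphere 0 1 \<inter> W"
  have scaleW: "c *\<^sub>R x \<in> W" if "x \<in> W" for x and c :: real
    using that by (simp add: W_def)
  have addW: "x + y \<in> W" if "x \<in> W" "y \<in> W" for x y
    using that by (simp add: W_def inner_add_left)
  have AW: "A *v x \<in> W" if "x \<in> W" for x
    unfolding W_def
  proof safe
    fix u assume u: "u \<in> S"
    then obtain l where "A *v u = l *\<^sub>R u"
      using eig by blast
    then show "(A *v x) \<bullet> u = 0"
      using that u symmetric_matrix_inner[OF sym, of x u] by (simp add: W_def)
  qed
  have "W = (\<Inter>u\<in>S. {x. u \<bullet> x = 0})"
    by (auto simp: W_def inner_commute)
  then have "closed W"
    by (simp add: closed_INT closed_hyperplane)
  then have "compact K"
    by (simp add: K_def compact_Int_closed)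
  moreover have "K \<noteq> {}"
  proof -
    obtain x where "x \<noteq> 0" "\<And>u. u \<in> S \<Longrightarrow> x \<bullet> u = 0"
      using exists_orthogonal_vector[OF fin] card by auto
    then have "(1 / norm x) *\<^sub>R x \<in> K"
      by (auto simp: K_def W_def)
    then show ?thesis by blast
  qed
  moreover have "continuous_on K (\<lambda>x. x \<bullet> (A *v x))"
    by (intro continuous_intros matrix_vector_mult_linear_continuous_on)
  ultimately obtain v where v: "v \<in> K" and vmax: "\<And>y. y \<in> K \<Longrightarrow> y \<bullet> (A *v y) \<le> v \<bullet> (A *v v)"
    using continuous_attains_sup[of K "\<lambda>x. x \<bullet> (A *v x)"] by blast
  have v1: "norm v = 1" and vW: "v \<in> W"
    using v by (auto simp: K_def)
  define m where "m = v \<bullet> (A *v v)"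
  define Q where "Q x = m * (x \<bullet> x) - x \<bullet> (A *v x)" for x
  have Qnonneg: "0 \<le> Q x" if "x \<in> W" for x
  proof (cases "x = 0")
    case False
    define y where "y = (1 / norm x) *\<^sub>R x"
    have "y \<in> K"
      using False that scaleW by (auto simp: K_def y_def)
    then have "y \<bullet> (A *v y) \<le> m"
      using vmax m_def by blast
    moreover have "x = norm x *\<^sub>R y"
      using False by (simp add: y_def)
    then have "x \<bullet> (A *v x) = (norm x)\<^sup>2 * (y \<bullet> (A *v y))"
      by (metis (no_types) inner_scaleR_left inner_scaleR_right matrix_vector_mult_scaleR mult.assoc power2_eq_square)
    ultimately show ?thesis
      using mult_left_mono[of "y \<bullet> (A *v y)" m "(norm x)\<^sup>2"]
      by (simp add: Q_def dot_square_norm mult.commute)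
  qed (simp add: Q_def)
  \<comment> \<open>The residual of the eigenvector equation is half the gradient of
    \<open>Q\<close> at \<open>v\<close>. It lies in \<open>W\<close>, so moving from
    \<open>v\<close> along \<open>w\<close> stays where \<open>Q\<close> is nonnegative.\<close>
  define w where "w = m *\<^sub>R v - A *v v"
  have wW: "w \<in> W"
    using addW[OF scaleW[OF vW, of m] scaleW[OF AW[OF vW], of "-1"]] by (simp add: w_def)
  \<comment> \<open>The maximality of \<open>v\<close> makes \<open>t \<mapsto> Q (v + t w)\<close> nonnegative with a zero at \<open>t = 0\<close>, so its
    linear coefficient, which is \<open>2 \<parallel>w\<parallel>\<^sup>2\<close>, vanishes.\<close>
  have expand: "Q (v + t *\<^sub>R w) = 2 * t * (w \<bullet> w) + t\<^sup>2 * Q w" for t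
  proof -
    have Aw: "w \<bullet> (A *v v) = v \<bullet> (A *v w)"
      by (metis symmetric_matrix_inner[OF sym] inner_commute)
    have "w \<bullet> w = m * (w \<bullet> v) - v \<bullet> (A *v w)"
      by (subst (2) w_def) (simp add: inner_diff_right Aw)
    moreover have "v \<bullet> v = 1"
      using v1 by (simp add: dot_square_norm)
    then have "Q (v + t *\<^sub>R w) = 2 * t * (m * (w \<bullet> v) - v \<bullet> (A *v w)) + t\<^sup>2 * Q w"
      by (simp add: Q_def inner_add_left inner_add_right matrix_vector_right_distrib
          matrix_vector_mult_scaleR m_def[symmetric] inner_commute[of v w] Aw power2_eq_square
          algebra_simps)
    ultimately show ?thesis
      by simp
  qed
  have "w \<bullet> w = 0"
  proof (rule ccontr)
    assume "w \<bullet> w \<noteq> 0"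
    then have pos: "0 < w \<bullet> w"
      by (simp add: order_less_le)
    have Qw: "0 \<le> Q w"
      using Qnonneg wW .
    \<comment> \<open>The quadratic in \<open>t\<close> is minimal at
      \<open>- (w \<bullet> w) / Q w\<close>. Adding 1 to the denominator avoids division by zero
      and still gives \<open>t * Q w \<ge> - (w \<bullet> w)\<close>.\<close>
    define t where "t = - (w \<bullet> w) / (Q w + 1)"
    have "0 \<le> 2 * t * (w \<bullet> w) + t\<^sup>2 * Q w"
      using Qnonneg[OF addW[OF vW scaleW[OF wW]]] expand by metis
    also have "\<dots> = t * (2 * (w \<bullet> w) + t * Q w)"
      by (simp add: power2_eq_square algebra_simps)
    also have "\<dots> < 0"
    proof (rule mult_neg_pos)
      show "t < 0"
        using pos Qw by (simp add: t_def divide_neg_pos)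
      have "(w \<bullet> w) * (Q w / (Q w + 1)) \<le> (w \<bullet> w) * 1"
        using pos Qw by (intro mult_left_mono) auto
      moreover have "t * Q w = - ((w \<bullet> w) * (Q w / (Q w + 1)))"
        by (simp add: t_def)
      ultimately show "0 < 2 * (w \<bullet> w) + t * Q w"
        using pos by linarith
    qed
    finally show False by simp
  qed
  then have "A *v v = m *\<^sub>R v"
    by (simp add: w_def)
  then show thesis
    using that v1 vW by (auto simp: W_def)
qed

text \<open>Indexing by \<open>'n\<close> instead of using a set of eigenvalues keeps repeated ones,
  so sums over \<open>UNIV\<close> count multiplicity.\<close>

definition orthonormal_eigenbasis ::
    "real ^ 'n ^ 'n \<Rightarrow> ('n \<Rightarrow> real ^ 'n) \<Rightarrow> ('n \<Rightarrow> real) \<Rightarrow> bool" where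
  "orthonormal_eigenbasis A v l \<longleftrightarrow>
    (\<forall>i j. v i \<bullet> v j = (if i = j then 1 else 0)) \<and> (\<forall>i. A *v v i = l i *\<^sub>R v i)"

text \<open>Unit eigenvectors are added one at a time, each orthogonal to the earlier ones, until
  there are \<open>CARD('n)\<close> of them; a bijection then indexes the set.\<close>

lemma symmetric_matrix_orthonormal_eigenbasis:
  fixes A :: "real ^ 'n ^ 'n"
  assumes sym: "symmetric_matrix A"
  obtains v l where "orthonormal_eigenbasis A v l"
proof -
  have "\<exists>S. finite S \<and> card S = k \<and> (\<forall>u\<in>S. norm u = 1 \<and> (\<exists>l. A *v u = l *\<^sub>R u)) \<and>
      (\<forall>u\<in>S. \<forall>w\<in>S. u \<noteq> w \<longrightarrow> u \<bullet> w = 0)" if "k \<le> CARD('n)" for k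
    using that
  proof (induction k)
    case 0
    then show ?case by (intro exI[of _ "{}"]) simp
  next
    case (Suc k)
    then obtain S where S: "finite S" "card S = k"
      "\<forall>u\<in>S. norm u = 1 \<and> (\<exists>l. A *v u = l *\<^sub>R u)"
      "\<forall>u\<in>S. \<forall>w\<in>S. u \<noteq> w \<longrightarrow> u \<bullet> w = 0"
      by auto
    obtain v m where v: "norm v = 1" "A *v v = m *\<^sub>R v" "\<And>u. u \<in> S \<Longrightarrow> v \<bullet> u = 0"
      using symmetric_matrix_eigenvector_orthogonal[OF sym S(1)] S Suc.prems by auto
    have "v \<notin> S"
      using v by (metis inner_eq_zero_iff norm_zero zero_neq_one)
    then show ?case
      using S v by (intro exI[of _ "insert v S"]) (auto simp: inner_commute)
  qed
  then obtain S where S: "finite S" "card S = CARD('n)"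
      "\<And>u. u \<in> S \<Longrightarrow> norm u = 1" "\<And>u. u \<in> S \<Longrightarrow> \<exists>l. A *v u = l *\<^sub>R u"
      "\<And>u w. u \<in> S \<Longrightarrow> w \<in> S \<Longrightarrow> u \<noteq> w \<Longrightarrow> u \<bullet> w = 0"
    by (metis order_refl)
  obtain v :: "'n \<Rightarrow> real ^ 'n" where v: "bij_betw v UNIV S"
    using S(1,2) by (metis finite_class.finite_UNIV finite_same_card_bij)
  have vS: "v i \<in> S" for i
    using v by (auto simp: bij_betw_def)
  have "\<exists>l. \<forall>i. A *v v i = l i *\<^sub>R v i"
    using S(4)[OF vS] by (intro choice) simp
  then obtain l where "\<And>i. A *v v i = l i *\<^sub>R v i"
    by blast
  moreover have "v i \<bullet> v j = (if i = j then 1 else 0)" for i j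
    using S(3)[OF vS, of i] S(5)[OF vS vS, of i j] v
    by (auto simp: bij_betw_def inj_def dot_square_norm)
  ultimately have "orthonormal_eigenbasis A v l"
    unfolding orthonormal_eigenbasis_def by blast
  then show thesis
    by (rule that)
qed

section \<open>Coordinates and characteristic polynomial in an eigenbasis\<close>

context
  fixes A :: "real ^ 'n ^ 'n" and v :: "'n \<Rightarrow> real ^ 'n" and l :: "'n \<Rightarrow> real"
  assumes basis: "orthonormal_eigenbasis A v l"
begin

lemma orthonormal_eigenbasis_inner: "v i \<bullet> v j = (if i = j then 1 else 0)"
  using basis by (simp add: orthonormal_eigenbasis_def)

lemma orthonormal_eigenbasis_norm: "norm (v i) = 1"
  using orthonormal_eigenbasis_inner[of i i] by (simp add: norm_eq_1)

lemma orthonormal_eigenbasis_eigenvector: "A *v v i = l i *\<^sub>R v i"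
  using basis by (simp add: orthonormal_eigenbasis_def)

lemma orthonormal_eigenbasis_inj: "inj v"
  by (metis injI orthonormal_eigenbasis_inner zero_neq_one)

text \<open>The residual \<open>y\<close> is orthogonal to every \<open>v j\<close>. These are
  \<open>CARD('n)\<close> independent vectors and hence span the space, so \<open>y\<close> is
  orthogonal to itself.\<close>

lemma orthonormal_eigenbasis_expand: "x = (\<Sum>i\<in>UNIV. (x \<bullet> v i) *\<^sub>R v i)"
proof -
  define y where "y = x - (\<Sum>i\<in>UNIV. (x \<bullet> v i) *\<^sub>R v i)"
  have "y \<bullet> v j = 0" for j
    by (simp add: y_def inner_diff_left inner_sum_left orthonormal_eigenbasis_inner if_distrib cong: if_cong)
  moreover have "span (range v) = UNIV"
  proof -
    have "pairwise orthogonal (range v)" "0 \<notin> range v"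
      using orthonormal_eigenbasis_inner orthonormal_eigenbasis_norm
      by (auto simp: pairwise_def orthogonal_def) (metis norm_zero zero_neq_one)
    then have "independent (range v)"
      by (rule pairwise_orthogonal_independent)
    moreover have "card (range v) = DIM(real ^ 'n)"
      by (simp add: card_image orthonormal_eigenbasis_inj)
    ultimately show ?thesis
      by (metis card_eq_dim dim_eq_full dim_span finite subset_UNIV order_refl dim_eq_card_independent)
  qed
  ultimately have "y \<bullet> y = 0"
    by (metis UNIV_I orthogonal_def orthogonal_to_span rangeE)
  then show ?thesis by (simp add: y_def)
qed

lemma orthonormal_eigenbasis_inner_self: "x \<bullet> x = (\<Sum>i\<in>UNIV. (x \<bullet> v i)\<^sup>2)"
  by (subst (2) orthonormal_eigenbasis_expand) (simp add: inner_sum_right power2_eq_square)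

lemma orthonormal_eigenbasis_quadratic_form:
  "x \<bullet> (A *v x) = (\<Sum>i\<in>UNIV. l i * (x \<bullet> v i)\<^sup>2)"
  by (subst (2) orthonormal_eigenbasis_expand)
    (simp add: inner_sum_right power2_eq_square matrix_vector_mult_scaleR
      orthonormal_eigenbasis_eigenvector linear_sum[OF matrix_vector_mul_linear] mult_ac)

text \<open>The eigenvector matrix \<open>P\<close> satisfies \<open>A ** P = P ** D\<close> with
  \<open>D\<close> diagonal. The entrywise embedding \<open>L\<close> carries this to polynomial
  matrices, where \<open>X\<close> is a scalar matrix and so commutes with everything; taking
  determinants and cancelling \<open>det (L P)\<close> gives the factorisation.\<close>

lemma orthonormal_eigenbasis_charpoly: "charpoly A = (\<Prod>i\<in>UNIV. [:- l i, 1:])"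
proof -
  define L :: "real ^ 'n ^ 'n \<Rightarrow> real poly ^ 'n ^ 'n" where "L M = (\<chi> i j. [:M $ i $ j:])" for M
  define X :: "real poly ^ 'n ^ 'n" where "X = (\<chi> i j. if i = j then [:0, 1:] else 0)"
  define P :: "real ^ 'n ^ 'n" where "P = (\<chi> i j. v j $ i)"
  define D :: "real ^ 'n ^ 'n" where "D = (\<chi> i j. if i = j then l i else 0)"
  have L_mult: "L (M ** N) = L M ** L N" for M N
    by (simp add: L_def matrix_matrix_mult_def sum_to_poly mult_to_poly vec_eq_iff mult.commute)
  have L_one: "L (mat 1) = mat 1"
    by (simp add: L_def mat_def vec_eq_iff one_pCons)
  have X_comm: "X ** M = M ** X" for M
    by (simp add: X_def matrix_matrix_mult_def vec_eq_iff if_distrib if_distribR mult.commute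
        cong: if_cong)
  have diff_left: "(M - N) ** K = M ** K - N ** K" for M N K :: "real poly ^ 'n ^ 'n"
    by (simp add: matrix_matrix_mult_def vec_eq_iff left_diff_distrib sum_subtractf)
  have diff_right: "K ** (M - N) = K ** M - K ** N" for M N K :: "real poly ^ 'n ^ 'n"
    by (simp add: matrix_matrix_mult_def vec_eq_iff right_diff_distrib sum_subtractf)
  have "A ** P = P ** D"
  proof -
    have "(A ** P) $ i $ j = (A *v v j) $ i" for i j
      by (simp add: P_def matrix_matrix_mult_def matrix_vector_mult_def)
    then show ?thesis
      by (simp add: orthonormal_eigenbasis_eigenvector vec_eq_iff)
        (simp add: P_def D_def matrix_matrix_mult_def if_distrib mult.commute cong: if_cong)
  qed
  then have "(X - L A) ** L P = L P ** (X - L D)"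
    by (simp add: diff_left diff_right L_mult[symmetric] X_comm)
  then have "det (X - L A) * det (L P) = det (L P) * det (X - L D)"
    by (metis det_mul)
  moreover have "det (L P) \<noteq> 0"
  proof -
    have "transpose P ** P = mat 1"
      using orthonormal_eigenbasis_inner
      by (simp add: P_def matrix_matrix_mult_def transpose_def mat_def vec_eq_iff inner_vec_def)
    then have "det (L (transpose P)) * det (L P) = 1"
      by (metis L_mult L_one det_I det_mul)
    then show ?thesis by auto
  qed
  ultimately have "det (X - L A) = det (X - L D)"
    by simp
  also have "\<dots> = (\<Prod>i\<in>UNIV. (X - L D) $ i $ i)"
    by (rule det_diagonal) (simp add: X_def L_def D_def)
  also have "\<dots> = (\<Prod>i\<in>UNIV. [:- l i, 1:])"
    by (simp add: X_def L_def D_def)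
  also have "X - L A = (\<chi> i j. (if i = j then [:0, 1:] else 0) - [:A $ i $ j:])"
    by (simp add: X_def L_def vec_eq_iff)
  finally show ?thesis
    by (simp add: charpoly_def)
qed

text \<open>This turns the trace in \<open>renyi_entropy\<close> into a sum over indices.\<close>

lemma orthonormal_eigenbasis_eigenvalues: "eigenvalues A = image_mset l (mset_set UNIV)"
proof -
  have "proots (\<Prod>i\<in>UNIV. [:- l i, 1:]) = (\<Sum>i\<in>UNIV. {#l i#})"
    by (subst proots_prod) simp_all
  also have "\<dots> = image_mset l (mset_set UNIV)"
    by (simp add: sum_unfold_sum_mset)
  finally show ?thesis
    by (simp add: eigenvalues_def orthonormal_eigenbasis_charpoly)
qed

end

section \<open>Comparison of spectra and of traces of powers\<close>

lemma card_eigenvalues_greater_mono: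
  fixes A B :: "real ^ 'n ^ 'n"
  assumes A: "orthonormal_eigenbasis A v l" and B: "orthonormal_eigenbasis B w m"
    and le: "\<And>x. x \<bullet> (A *v x) \<le> c * (x \<bullet> (B *v x))"
  shows "card {i. t < l i} \<le> card {i. t < c * m i}"
proof (rule ccontr)
  assume less: "\<not> ?thesis"
  \<comment> \<open>A vector orthogonal to \<open>S\<close> has only components with
    \<open>l i > t\<close> in the basis \<open>v\<close> and only components with
    \<open>c * m i \<le> t\<close> in the basis \<open>w\<close>. If the claim fails,
    \<open>S\<close> is too small to exclude a nonzero such vector.\<close>
  define S where "S = v ` {i. l i \<le> t} \<union> w ` {i. t < c * m i}"
  have "card S \<le> card (v ` {i. l i \<le> t}) + card (w ` {i. t < c * m i})"
    unfolding S_def by (rule card_Un_le)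
  also have "\<dots> \<le> card {i. l i \<le> t} + card {i. t < c * m i}"
    by (intro add_mono card_image_le) auto
  also have "\<dots> < card {i. l i \<le> t} + card {i. t < l i}"
    using less by simp
  also have "\<dots> = card ({i. l i \<le> t} \<union> {i. t < l i})"
    by (rule card_Un_disjoint[symmetric]) auto
  also have "{i. l i \<le> t} \<union> {i. t < l i} = UNIV"
    by auto
  finally have "card S < DIM(real ^ 'n)"
    by simp
  moreover have "finite S"
    by (simp add: S_def)
  ultimately obtain x where "x \<noteq> 0" and x: "\<And>y. y \<in> S \<Longrightarrow> x \<bullet> y = 0"
    using exists_orthogonal_vector by blast
  have "(\<Sum>i\<in>UNIV. (x \<bullet> v i)\<^sup>2) \<noteq> 0"
    using orthonormal_eigenbasis_inner_self[OF A, of x] \<open>x \<noteq> 0\<close> by (metis inner_eq_zero_iff)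
  then obtain k where k: "x \<bullet> v k \<noteq> 0"
    by (metis (no_types, lifting) sum.neutral zero_power2)
  have pos: "t < l i" if "x \<bullet> v i \<noteq> 0" for i
    using that x[of "v i"] by (force simp: S_def)
  have neg: "c * m i \<le> t" if "x \<bullet> w i \<noteq> 0" for i
    using that x[of "w i"] by (force simp: S_def)
  \<comment> \<open>The two expansions squeeze \<open>t * (x \<bullet> x)\<close> between the forms
    in the order opposite to \<open>le\<close>; the nonzero coordinate \<open>k\<close> makes one
    inequality strict.\<close>
  have "c * (x \<bullet> (B *v x)) = (\<Sum>i\<in>UNIV. c * m i * (x \<bullet> w i)\<^sup>2)"
    by (simp add: orthonormal_eigenbasis_quadratic_form[OF B] sum_distrib_left mult_ac)
  also have "\<dots> \<le> (\<Sum>i\<in>UNIV. t * (x \<bullet> w i)\<^sup>2)"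
    using neg by (intro sum_mono) (metis mult_right_mono mult_zero_right order_refl power_zero_numeral zero_le_power2)
  also have "\<dots> = t * (x \<bullet> x)"
    by (simp add: orthonormal_eigenbasis_inner_self[OF B] sum_distrib_left)
  also have "\<dots> = (\<Sum>i\<in>UNIV. t * (x \<bullet> v i)\<^sup>2)"
    by (simp add: orthonormal_eigenbasis_inner_self[OF A] sum_distrib_left)
  also have "\<dots> < (\<Sum>i\<in>UNIV. l i * (x \<bullet> v i)\<^sup>2)"
  proof (rule sum_strict_mono_ex1)
    show "\<forall>i\<in>UNIV. t * (x \<bullet> v i)\<^sup>2 \<le> l i * (x \<bullet> v i)\<^sup>2"
      using pos by (metis less_imp_le mult_right_mono mult_zero_right order_refl power_zero_numeral zero_le_power2)
    show "\<exists>i\<in>UNIV. t * (x \<bullet> v i)\<^sup>2 < l i * (x \<bullet> v i)\<^sup>2"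
      using pos[OF k] k by (intro bexI[of _ k]) auto
  qed simp
  also have "\<dots> = x \<bullet> (A *v x)"
    by (simp add: orthonormal_eigenbasis_quadratic_form[OF A])
  also have "\<dots> \<le> c * (x \<bullet> (B *v x))"
    by (rule le)
  finally show False by simp
qed

text \<open>Comparing counts above each threshold replaces sorting. The induction adds a largest
  \<open>a x\<close>, pairs it with a largest \<open>b y\<close> and removes both; terms of
  \<open>J\<close> left over at the end are harmless because \<open>f\<close> is
  nonnegative.\<close>

lemma sum_mono_of_card_greater_mono:
  fixes a :: "'a \<Rightarrow> real" and b :: "'b \<Rightarrow> real" and f :: "real \<Rightarrow> real"
  assumes "finite I" "finite J"
    and "\<And>t. card {i \<in> I. t < a i} \<le> card {j \<in> J. t < b j}"
    and "\<And>i. i \<in> I \<Longrightarrow> a i \<in> S" "\<And>j. j \<in> J \<Longrightarrow> b j \<in> S"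
    and f: "mono_on S f" "\<And>x. x \<in> S \<Longrightarrow> 0 \<le> f x"
  shows "(\<Sum>i\<in>I. f (a i)) \<le> (\<Sum>j\<in>J. f (b j))"
  using assms(1-5)
proof (induction I arbitrary: J rule: finite_ranking_induct[where f = a])
  case empty
  then show ?case
    using f(2) by (simp add: sum_nonneg)
next
  case (insert x I)
  show ?case
  proof (cases "x \<in> I")
    case True
    then show ?thesis
      using insert by (simp add: insert_absorb)
  next
    case x: False
    have ex: "\<exists>j\<in>J. t < b j" if "t < a x" for t
    proof -
      have "card {i \<in> insert x I. t < a i} \<noteq> 0"
        using that insert(1) by auto
      then have "card {j \<in> J. t < b j} \<noteq> 0"
        using insert(5)[of t] by linarith
      then show ?thesis by (metis (mono_tags, lifting) card.empty empty_Collect_eq)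
    qed
    from ex[of "a x - 1"] have J: "J \<noteq> {}" by auto
    have "Max (b ` J) \<in> b ` J"
      using J insert(4) by (intro Max_in) auto
    then obtain y where y: "y \<in> J" and "b y = Max (b ` J)"
      by auto
    then have ymax: "b j \<le> b y" if "j \<in> J" for j
      using that insert(4) by simp
    \<comment> \<open>Otherwise the threshold \<open>b y\<close> would lie below \<open>a x\<close>,
      and some \<open>b j\<close> would exceed the maximum \<open>b y\<close>.\<close>
    have axy: "a x \<le> b y"
      using ex[of "b y"] ymax by force
    have "(\<Sum>i\<in>I. f (a i)) \<le> (\<Sum>j\<in>J - {y}. f (b j))"
    proof (rule insert(3))
      \<comment> \<open>For \<open>t\<close> below \<open>a x\<close> both counts drop by exactly
        one; for larger \<open>t\<close> the left count is zero.\<close>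
      show "card {i \<in> I. t < a i} \<le> card {j \<in> J - {y}. t < b j}" for t
      proof (cases "t < a x")
        case True
        have "{i \<in> insert x I. t < a i} = insert x {i \<in> I. t < a i}"
          using True by auto
        then have "card {i \<in> insert x I. t < a i} = Suc (card {i \<in> I. t < a i})"
          using x insert(1) by simp
        moreover have "{j \<in> J. t < b j} = insert y {j \<in> J - {y}. t < b j}"
          using True axy y by auto
        then have "card {j \<in> J. t < b j} = Suc (card {j \<in> J - {y}. t < b j})"
          using insert(4) by simp
        ultimately show ?thesis
          using insert(5)[of t] by linarith
      next
        case False
        then have "{i \<in> I. t < a i} = {}"
          using insert(2) by force
        then show ?thesis
          by (metis card.empty le0)
      qed
    qed (use insert in auto)
    moreover have "f (a x) \<le> f (b y)"
      using f(1) axy insert(6)[of x] insert(7)[OF y] by (auto simp: mono_on_def)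
    ultimately show ?thesis
      using x insert(1) sum.remove[OF insert(4) y, of "\<lambda>j. f (b j)"] by simp
  qed
qed

text \<open>Only traces are compared: for \<alpha> > 1 the matrix power itself is not monotone in
  the order of quadratic forms, but the eigenvalue counts are.\<close>

lemma trace_powr_le_of_quadratic_form_le:
  fixes A B :: "real ^ 'n ^ 'n"
  assumes A: "orthonormal_eigenbasis A v l" and B: "orthonormal_eigenbasis B w m"
    and le: "\<And>x. x \<bullet> (A *v x) \<le> c * (x \<bullet> (B *v x))"
    and nonneg: "\<And>i. 0 \<le> l i" "\<And>i. 0 \<le> m i" "0 \<le> c" "0 \<le> \<alpha>"
  shows "(\<Sum>i\<in>UNIV. l i powr \<alpha>) \<le> c powr \<alpha> * (\<Sum>i\<in>UNIV. m i powr \<alpha>)"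
proof -
  have "(\<Sum>i\<in>UNIV. l i powr \<alpha>) \<le> (\<Sum>i\<in>UNIV. (c * m i) powr \<alpha>)"
    using card_eigenvalues_greater_mono[OF A B le] nonneg
    by (intro sum_mono_of_card_greater_mono[where S = "{0..}" and f = "\<lambda>x. x powr \<alpha>"])
      (auto simp: mono_on_def powr_mono2)
  also have "\<dots> = c powr \<alpha> * (\<Sum>i\<in>UNIV. m i powr \<alpha>)"
    using nonneg by (simp add: powr_mult sum_distrib_left)
  finally show ?thesis .
qed

section \<open>Spectral norm estimates\<close>

lemma norm_matrix_vector_le_spectral_norm:
  fixes A :: "real ^ 'n ^ 'm"
  shows "norm (A *v x) \<le> spectral_norm A * norm x"
  unfolding spectral_norm_def by (intro onorm matrix_vector_mul_bounded_linear)

lemma spectral_norm_nonneg: "0 \<le> spectral_norm A"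
  unfolding spectral_norm_def by (intro onorm_pos_le matrix_vector_mul_bounded_linear)

lemma abs_quadratic_form_le_spectral_norm:
  fixes A :: "real ^ 'n ^ 'n"
  shows "\<bar>x \<bullet> (A *v x)\<bar> \<le> spectral_norm A * (x \<bullet> x)"
proof -
  have "\<bar>x \<bullet> (A *v x)\<bar> \<le> norm x * norm (A *v x)"
    by (rule Cauchy_Schwarz_ineq2)
  also have "\<dots> \<le> norm x * (spectral_norm A * norm x)"
    by (intro mult_left_mono norm_matrix_vector_le_spectral_norm) simp
  finally show ?thesis
    by (simp add: dot_square_norm power2_eq_square mult_ac)
qed

text \<open>Apply the inverse to the eigenvector equation and take norms, using that
  \<open>v i\<close> is a unit vector.\<close>

lemma one_le_spectral_norm_inverse_mult_eigenvalue:
  fixes A :: "real ^ 'n ^ 'n"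
  assumes "orthonormal_eigenbasis A v l" "invertible A"
  shows "1 \<le> spectral_norm (matrix_inv A) * \<bar>l i\<bar>"
proof -
  have "matrix_inv A *v (A *v v i) = v i"
    using someI_ex[OF assms(2)[unfolded invertible_def]]
    by (simp add: matrix_vector_mul_assoc matrix_inv_def)
  then have "norm (v i) \<le> spectral_norm (matrix_inv A) * norm (l i *\<^sub>R v i)"
    by (metis norm_matrix_vector_le_spectral_norm orthonormal_eigenbasis_eigenvector[OF assms(1)])
  then show ?thesis
    by (simp add: orthonormal_eigenbasis_norm[OF assms(1)])
qed

section \<open>Entropy under a relative perturbation of the quadratic form\<close>

theorem theorem5:
  fixes G G' :: "real ^ 'n ^ 'n" and \<alpha> :: real
  assumes "\<alpha> > 0" and "\<alpha> \<noteq> 1"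
    and "pos_semidef G" and "invertible G"
    and "symmetric_matrix G'"
    and "1 - sqrt (real CARD('n)) * spectral_norm (matrix_inv G) * spectral_norm (G - G') > 0"
  shows "\<bar>renyi_entropy \<alpha> G - renyi_entropy \<alpha> G'\<bar>
    \<le> \<bar>\<alpha> / (1 - \<alpha>) *
        log 2 (1 - sqrt (real CARD('n)) * spectral_norm (matrix_inv G) * spectral_norm (G - G'))\<bar>"
proof -
  have "symmetric_matrix G"
    using assms(3) by (simp add: pos_semidef_def)
  then obtain v l where G: "orthonormal_eigenbasis G v l"
    by (rule symmetric_matrix_orthonormal_eigenbasis)
  obtain w m where G': "orthonormal_eigenbasis G' w m"
    using assms(5) by (rule symmetric_matrix_orthonormal_eigenbasis)
  define s where "s = spectral_norm (matrix_inv G)"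
  \<comment> \<open>All estimates are made with the smaller \<open>\<delta>\<close>;
    \<open>\<epsilon>\<close> enters only at the end, through monotonicity of the logarithm.\<close>
  define \<delta> where "\<delta> = s * spectral_norm (G - G')"
  define \<epsilon> where "\<epsilon> = sqrt (real CARD('n)) * spectral_norm (matrix_inv G) * spectral_norm (G - G')"
  have \<delta>0: "0 \<le> \<delta>"
    by (simp add: \<delta>_def s_def spectral_norm_nonneg)
  have "1 * \<delta> \<le> sqrt (real CARD('n)) * \<delta>"
    using \<delta>0 by (intro mult_right_mono) (simp_all add: Suc_leI)
  then have \<delta>\<epsilon>: "\<delta> \<le> \<epsilon>"
    by (simp add: \<delta>_def \<epsilon>_def s_def mult_ac)
  have \<epsilon>1: "\<epsilon> < 1"
    using assms(6) by (simp add: \<epsilon>_def)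
  have l0: "0 \<le> l i" for i
  proof -
    have "0 \<le> v i \<bullet> (G *v v i)"
      using assms(3) by (simp add: pos_semidef_def)
    then show ?thesis
      by (simp add: orthonormal_eigenbasis_eigenvector[OF G] orthonormal_eigenbasis_inner[OF G])
  qed
  have l1: "1 \<le> s * l i" for i
    using one_le_spectral_norm_inverse_mult_eigenvalue[OF G assms(4), of i] l0[of i]
    by (simp add: s_def)
  have inv: "x \<bullet> x \<le> s * (x \<bullet> (G *v x))" for x
  proof -
    have "x \<bullet> x = (\<Sum>i\<in>UNIV. 1 * (x \<bullet> v i)\<^sup>2)"
      by (simp add: orthonormal_eigenbasis_inner_self[OF G])
    also have "\<dots> \<le> (\<Sum>i\<in>UNIV. (s * l i) * (x \<bullet> v i)\<^sup>2)"
      by (intro sum_mono mult_right_mono l1) simp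
    finally show ?thesis
      by (simp add: orthonormal_eigenbasis_quadratic_form[OF G] sum_distrib_left mult_ac)
  qed
  have "\<bar>x \<bullet> (G *v x) - x \<bullet> (G' *v x)\<bar> \<le> \<delta> * (x \<bullet> (G *v x))" for x
  proof -
    have "\<bar>x \<bullet> (G *v x) - x \<bullet> (G' *v x)\<bar> \<le> spectral_norm (G - G') * (x \<bullet> x)"
      using abs_quadratic_form_le_spectral_norm[of x "G - G'"]
      by (simp add: matrix_vector_mult_diff_rdistrib inner_diff_right)
    also have "\<dots> \<le> spectral_norm (G - G') * (s * (x \<bullet> (G *v x)))"
      by (intro mult_left_mono inv spectral_norm_nonneg)
    finally show ?thesis
      by (simp add: \<delta>_def mult_ac)
  qed
  then have bounds: "x \<bullet> (G' *v x) \<le> (1 + \<delta>) * (x \<bullet> (G *v x))"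
      "(1 - \<delta>) * (x \<bullet> (G *v x)) \<le> x \<bullet> (G' *v x)" for x
    by (simp_all add: abs_le_iff algebra_simps)
  \<comment> \<open>\<open>G'\<close> is only assumed symmetric; the lower form bound with \<delta>
    < 1 makes it positive semidefinite, so the powers act on nonnegative numbers.\<close>
  have m0: "0 \<le> m i" for i
  proof -
    have "0 \<le> (1 - \<delta>) * (w i \<bullet> (G *v w i))"
      using \<delta>\<epsilon> \<epsilon>1 assms(3) by (simp add: pos_semidef_def)
    also have "\<dots> \<le> w i \<bullet> (G' *v w i)"
      by (rule bounds)
    finally show ?thesis
      by (simp add: orthonormal_eigenbasis_eigenvector[OF G'] orthonormal_eigenbasis_inner[OF G'])
  qed
  define T where "T = (\<Sum>i\<in>UNIV. l i powr \<alpha>)"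
  define T' where "T' = (\<Sum>i\<in>UNIV. m i powr \<alpha>)"
  have "l i \<noteq> 0" for i
    using l1[of i] by auto
  then have T: "0 < T"
    unfolding T_def by (intro sum_pos) auto
  have up: "T' \<le> (1 + \<delta>) powr \<alpha> * T"
    unfolding T_def T'_def using \<delta>0 assms(1) l0 m0 bounds
    by (intro trace_powr_le_of_quadratic_form_le[OF G' G]) auto
  \<comment> \<open>The comparison lemma has its factor on the larger side, so
    \<open>1 - \<delta>\<close> is moved across as a reciprocal.\<close>
  have "T \<le> (1 / (1 - \<delta>)) powr \<alpha> * T'"
    unfolding T_def T'_def
  proof (rule trace_powr_le_of_quadratic_form_le[OF G G'])
    show "x \<bullet> (G *v x) \<le> 1 / (1 - \<delta>) * (x \<bullet> (G' *v x))" for x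
      using bounds(2)[of x] \<delta>\<epsilon> \<epsilon>1 by (simp add: field_simps)
  qed (use \<delta>\<epsilon> \<epsilon>1 assms(1) l0 m0 in auto)
  also have "\<dots> = T' / (1 - \<delta>) powr \<alpha>"
    using \<delta>\<epsilon> \<epsilon>1 by (simp add: powr_divide)
  finally have low: "(1 - \<delta>) powr \<alpha> * T \<le> T'"
    using \<delta>\<epsilon> \<epsilon>1 by (simp add: field_simps)
  have pos: "0 < (1 - \<delta>) powr \<alpha> * T"
    using T \<delta>\<epsilon> \<epsilon>1 by simp
  then have T': "0 < T'"
    using low by linarith
  have "log 2 ((1 - \<delta>) powr \<alpha> * T) \<le> log 2 T'"
    using low pos T' by simp
  then have lowlog: "\<alpha> * log 2 (1 - \<delta>) + log 2 T \<le> log 2 T'"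
    using T \<delta>\<epsilon> \<epsilon>1 by (simp add: log_mult log_powr)
  have "log 2 T' \<le> log 2 ((1 + \<delta>) powr \<alpha> * T)"
    using up T' T \<delta>0 by simp
  then have uplog: "log 2 T' \<le> \<alpha> * log 2 (1 + \<delta>) + log 2 T"
    using T \<delta>0 by (simp add: log_mult log_powr)
  \<comment> \<open>Since \<open>(1 + \<delta>) * (1 - \<delta>) \<le> 1\<close>, the upper
    deviation of \<open>log 2 T'\<close> is no worse than the lower one.\<close>
  have "1 + \<delta> \<le> 1 / (1 - \<delta>)"
    using \<delta>\<epsilon> \<epsilon>1 by (simp add: field_simps)
  then have "log 2 (1 + \<delta>) \<le> log 2 (1 / (1 - \<delta>))"
    using \<delta>0 \<delta>\<epsilon> \<epsilon>1 by (subst log_le_cancel_iff) auto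
  then have "log 2 (1 + \<delta>) \<le> - log 2 (1 - \<delta>)"
    using \<delta>\<epsilon> \<epsilon>1 by (simp add: log_divide)
  then have "\<alpha> * log 2 (1 + \<delta>) \<le> - (\<alpha> * log 2 (1 - \<delta>))"
    using assms(1) by (metis less_imp_le mult_left_mono mult_minus_right)
  with lowlog uplog have diff: "\<bar>log 2 T - log 2 T'\<bar> \<le> - (\<alpha> * log 2 (1 - \<delta>))"
    by linarith
  have "log 2 (1 - \<epsilon>) \<le> log 2 (1 - \<delta>)"
    using \<delta>\<epsilon> \<epsilon>1 by simp
  then have "\<alpha> * log 2 (1 - \<epsilon>) \<le> \<alpha> * log 2 (1 - \<delta>)"
    using assms(1) by simp
  with diff have main: "\<bar>log 2 T - log 2 T'\<bar> \<le> \<bar>\<alpha> * log 2 (1 - \<epsilon>)\<bar>"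
    by linarith
  have "renyi_entropy \<alpha> G = 1 / (1 - \<alpha>) * log 2 T" "renyi_entropy \<alpha> G' = 1 / (1 - \<alpha>) * log 2 T'"
    by (simp_all add: renyi_entropy_def orthonormal_eigenbasis_eigenvalues[OF G]
        orthonormal_eigenbasis_eigenvalues[OF G'] T_def T'_def sum_unfold_sum_mset
        image_mset.compositionality comp_def)
  \<comment> \<open>The factor \<open>1 / (1 - \<alpha>)\<close> is negative for \<alpha> > 1;
    pulling out its absolute value treats both ranges of \<alpha> at once.\<close>
  then have "\<bar>renyi_entropy \<alpha> G - renyi_entropy \<alpha> G'\<bar> = \<bar>1 / (1 - \<alpha>)\<bar> * \<bar>log 2 T - log 2 T'\<bar>"
    by (simp only: right_diff_distrib[symmetric] abs_mult)
  also have "\<dots> \<le> \<bar>1 / (1 - \<alpha>)\<bar> * \<bar>\<alpha> * log 2 (1 - \<epsilon>)\<bar>"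
    by (intro mult_left_mono main) simp
  also have "\<dots> = \<bar>\<alpha> / (1 - \<alpha>) * log 2 (1 - \<epsilon>)\<bar>"
    by (simp add: abs_mult[symmetric])
  finally show ?thesis
    by (simp add: \<epsilon>_def)
qed

end
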